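(* Let $1\le k_1<k_2<\cdots<k_s$ be fixed integers and let $P_{k_1,\dots,k_s}(x)$ be the characteristic polynomial of the minimal homogeneous linear recurrence with integer coefficients satisfied by the sequence $\{S_n\}_{n\in\mathbb{N}}$, where $$S_n=S(\sigma_{n,k_1}+\cdots+\sigma_{n,k_s})=\sum_{j=0}^n(-1)^{\binom{j}{k_1}+\cdots+\binom{j}{k_s}}\binom{n}{j}.$$ Let $\bar{k}=2\lfloor (k_1\vee\cdots\vee k_s)/2\rfloor+1$, with binary expansion $\bar k=1+2^{a_1}+\cdots+2^{a_l}$, $1\le a_1<\cdots<a_l=\lfloor\log_2(\bar k)\rfloor$. Then $P_{k_1,\dots,k_s}(x)$ divides $$(x-2)\prod_{j=1}^l\Phi_{2^{a_j+1}}(x-1).$$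
   Context: $\mathbb{N}=\{1,2,3,\dots\}$. For natural numbers $m,n$, $m\vee n$ is the natural number obtained by applying the bitwise OR coordinatewise to the binary digits of $m$ and $n$ (e.g. $3\vee 8=11$). $\Phi_m$ is the $m$-th cyclotomic polynomial. The sum $S_n$ is the exponential sum $\sum_{x\in\mathbb{F}_2^n}(-1)^{F(x)}$ of the symmetric Boolean function $F=\sigma_{n,k_1}+\cdots+\sigma_{n,k_s}$ ($\sigma_{n,k}$ the elementary symmetric polynomial of degree $k$ in $n$ variables), defined for all $n$ by the displayed binomial sum. A homogeneous linear recurrence $x_n=\sum_{i=1}^D a_ix_{n-i}$ with $a_i\in\mathbb{Z}$ has characteristic polynomial $x^D-\sum_{i=1}^D a_ix^{D-i}$; "minimal" means of least order. *)

theory Defs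
  imports "HOL-Analysis.Analysis" "HOL-Computational_Algebra.Computational_Algebra" "HOL-Library.Z2"
begin

definition elem_sym :: "nat \<Rightarrow> nat \<Rightarrow> (nat \<Rightarrow> bit) \<Rightarrow> bit" where
  "elem_sym n k x = (\<Sum>T | T \<subseteq> {1..n} \<and> card T = k. \<Prod>i\<in>T. x i)"

text \<open>Vectors of length n over the field with two elements are the extensional functions on
  the index set \<open>{1..n}\<close>.\<close>

definition exp_sum :: "nat \<Rightarrow> ((nat \<Rightarrow> bit) \<Rightarrow> bit) \<Rightarrow> int" where
  "exp_sum n F = (\<Sum>x\<in>PiE {1..n} (\<lambda>_. UNIV). if F x = 0 then 1 else - 1)"

definition sym_sum :: "nat list \<Rightarrow> nat \<Rightarrow> int" where
  "sym_sum ks n = (\<Sum>j=0..n. (- 1) ^ (\<Sum>k\<leftarrow>ks. j choose k) * int (n choose j))"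

lemma elem_sym_eq:
  "elem_sym n k x = of_nat (card {i\<in>{1..n}. x i = 1} choose k)"
proof -
  define A where "A = {i\<in>{1..n}. x i = 1}"
  have finA: "finite A" by (simp add: A_def)
  have prod_eq: "(\<Prod>i\<in>T. x i) = (if T \<subseteq> A then 1 else 0)" if "T \<subseteq> {1..n}" for T
  proof (cases "T \<subseteq> A")
    case True
    then have "(\<Prod>i\<in>T. x i) = (\<Prod>i\<in>T. 1)"
      by (intro prod.cong) (auto simp: A_def)
    with True show ?thesis by simp
  next
    case False
    then obtain i where "i \<in> T" "i \<notin> A" by blast
    then have "x i \<noteq> 1" using that by (auto simp: A_def)
    then have "x i = 0" by (cases "x i") auto
    moreover have "finite T" using that by (rule finite_subset) simp
    ultimately have "(\<Prod>i\<in>T. x i) = 0" using \<open>i \<in> T\<close> by (intro prod_zero) auto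
    with False show ?thesis by simp
  qed
  have "elem_sym n k x = (\<Sum>T | T \<subseteq> {1..n} \<and> card T = k. if T \<subseteq> A then 1 else 0)"
    unfolding elem_sym_def by (intro sum.cong refl prod_eq) auto
  also have "\<dots> = (\<Sum>T | T \<subseteq> A \<and> card T = k. 1)"
    by (intro sum.mono_neutral_cong_right) (auto simp: A_def)
  also have "\<dots> = of_nat (card A choose k)"
    using n_subsets[OF finA, of k] by simp
  finally show ?thesis by (simp add: A_def)
qed

lemma sum_list_elem_sym_eq:
  "(\<Sum>k\<leftarrow>ks. elem_sym n k x) = of_nat (\<Sum>k\<leftarrow>ks. card {i\<in>{1..n}. x i = 1} choose k)"
  by (induction ks) (simp_all add: elem_sym_eq)

lemma exp_sum_sym_eq_sym_sum:
  "exp_sum n (\<lambda>x. \<Sum>k\<leftarrow>ks. elem_sym n k x) = sym_sum ks n"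
proof -
  define g where "g j = (- 1 :: int) ^ (\<Sum>k\<leftarrow>ks. j choose k)" for j
  define supp where "supp x = {i\<in>{1..n}. x i = (1::bit)}" for x
  have bij: "bij_betw supp (PiE {1..n} (\<lambda>_. UNIV)) (Pow {1..n})"
  proof (rule bij_betw_byWitness[where f' = "\<lambda>A. restrict (\<lambda>i. of_bool (i \<in> A)) {1..n}"])
    show "\<forall>x\<in>PiE {1..n} (\<lambda>_. UNIV). restrict (\<lambda>i. of_bool (i \<in> supp x)) {1..n} = x"
    proof
      fix x :: "nat \<Rightarrow> bit" assume "x \<in> PiE {1..n} (\<lambda>_. UNIV)"
      then show "restrict (\<lambda>i. of_bool (i \<in> supp x)) {1..n} = x"
        by (intro extensionalityI[where A = "{1..n}"])
           (auto simp: PiE_def supp_def of_bool_def)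
    qed
  qed (auto simp: supp_def split: if_splits)
  have sign: "(if (of_nat m :: bit) = 0 then 1 else - 1) = (- 1 :: int) ^ m" for m
    by (cases "even m") (auto simp: of_nat_eq_iff elim!: evenE oddE)
  have "exp_sum n (\<lambda>x. \<Sum>k\<leftarrow>ks. elem_sym n k x)
      = (\<Sum>x\<in>PiE {1..n} (\<lambda>_. UNIV). g (card (supp x)))"
    unfolding exp_sum_def sum_list_elem_sym_eq sign g_def supp_def ..
  also have "\<dots> = (\<Sum>A\<in>Pow {1..n}. g (card A))"
    by (rule sum.reindex_bij_betw[OF bij])
  also have "\<dots> = (\<Sum>j=0..n. \<Sum>A | A \<in> Pow {1..n} \<and> card A = j. g (card A))"
  proof (rule sum.group[symmetric])
    show "card ` Pow {1..n} \<subseteq> {0..n}"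
    proof
      fix m assume "m \<in> card ` Pow {1..n}"
      then obtain A where "A \<subseteq> {1..n}" "m = card A" by blast
      then show "m \<in> {0..n}" using card_mono[of "{1..n}" A] by simp
    qed
  qed simp_all
  also have "\<dots> = (\<Sum>j=0..n. g j * int (n choose j))"
    using n_subsets[of "{1..n}"] by (intro sum.cong) simp_all
  finally show ?thesis by (simp add: sym_sum_def g_def)
qed

text \<open>Sequences are indexed by the positive integers, so a recurrence of order D is imposed
  exactly for \<open>n > D\<close> and the value at 0 is never used. The order may be 0: the zero
  sequence (which is \<open>sym_sum [1]\<close> on the positive integers) has
  minimal order 0 and characteristic polynomial 1.\<close>

definition satisfies_lin_rec :: "(nat \<Rightarrow> int) \<Rightarrow> nat \<Rightarrow> (nat \<Rightarrow> int) \<Rightarrow> bool" where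
  "satisfies_lin_rec x D a \<longleftrightarrow> (\<forall>n>D. x n = (\<Sum>i=1..D. a i * x (n - i)))"

definition minimal_lin_rec :: "(nat \<Rightarrow> int) \<Rightarrow> nat \<Rightarrow> (nat \<Rightarrow> int) \<Rightarrow> bool" where
  "minimal_lin_rec x D a \<longleftrightarrow>
     satisfies_lin_rec x D a \<and> (\<forall>D' a'. satisfies_lin_rec x D' a' \<longrightarrow> D \<le> D')"

definition rec_char_poly :: "nat \<Rightarrow> (nat \<Rightarrow> int) \<Rightarrow> int poly" where
  "rec_char_poly D a = monom 1 D - (\<Sum>i=1..D. monom (a i) (D - i))"

definition primitive_roots :: "nat \<Rightarrow> complex set" where
  "primitive_roots m = {z. z ^ m = 1 \<and> (\<forall>j. 0 < j \<and> j < m \<longrightarrow> z ^ j \<noteq> 1)}"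

definition cyclotomic :: "nat \<Rightarrow> int poly" where
  "cyclotomic m = (THE p. map_poly of_int p = (\<Prod>z\<in>primitive_roots m. [:- z, 1:]))"

lemma map_poly_of_int_mult:
  "map_poly of_int (p * q) = map_poly of_int p * (map_poly of_int q :: complex poly)"
  by (rule poly_eqI) (simp add: coeff_map_poly coeff_mult)

lemma map_poly_of_int_add:
  "map_poly of_int (p + q) = map_poly of_int p + (map_poly of_int q :: complex poly)"
  by (rule poly_eqI) (simp add: coeff_map_poly)

lemma map_poly_of_int_inj:
  "map_poly of_int p = (map_poly of_int q :: complex poly) \<Longrightarrow> p = q"
  by (simp add: poly_eq_iff coeff_map_poly)

lemma map_poly_of_int_prod:
  "map_poly of_int (\<Prod>i\<in>A. f i) = (\<Prod>i\<in>A. map_poly of_int (f i) :: complex poly)"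
  by (induction A rule: infinite_finite_induct) (simp_all add: map_poly_of_int_mult)

lemma exact_quotient_integral:
  fixes A B :: "int poly" and C :: "complex poly"
  assumes lead: "lead_coeff A = 1" and eq: "map_poly of_int B = map_poly of_int A * C"
  shows "\<exists>q. map_poly of_int q = C"
proof -
  obtain q r where qr: "pseudo_divmod B A = (q, r)" by force
  have "A \<noteq> 0" using lead by auto
  from pseudo_divmod[OF this qr] lead
  have BA: "B = A * q + r" and r: "r = 0 \<or> degree r < degree A" by simp_all
  let ?h = "map_poly of_int :: int poly \<Rightarrow> complex poly"
  have deg: "degree (?h p) = degree p" for p by (rule degree_map_poly) simp
  have "?h r = ?h A * (C - ?h q)"
    using eq by (simp add: BA map_poly_of_int_mult map_poly_of_int_add algebra_simps)
  moreover have "?h A \<noteq> 0" using \<open>A \<noteq> 0\<close> map_poly_of_int_inj[of A 0] by auto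
  ultimately have "C - ?h q = 0"
    using r deg[of r] deg[of A] degree_mult_eq[of "?h A" "C - ?h q"]
    by (cases "C - ?h q = 0") auto
  then show ?thesis by auto
qed

lemma prod_roots_unity:
  assumes "n > 0"
  shows "(\<Prod>z | z ^ n = (1::complex). [:- z, 1:]) = monom 1 n - 1"
proof -
  let ?p = "\<Prod>z | z ^ n = (1::complex). [:- z, 1:]"
  let ?q = "monom 1 n - 1 :: complex poly"
  have fin: "finite {z::complex. z ^ n = 1}"
    using finite_roots_unity[of n] assms by simp
  have card: "card {z::complex. z ^ n = 1} = n"
    using card_roots_unity_eq[OF assms] .
  have degp: "degree ?p = n"
    by (subst degree_prod_eq_sum_degree) (auto simp: card)
  have lcp: "coeff ?p n = 1"
    using lead_coeff_prod[of "\<lambda>z. [:- z, 1:]" "{z::complex. z ^ n = 1}"] degp by simp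
  have degq: "degree ?q \<le> n"
    by (rule degree_diff_le) (use degree_monom_le[of "1::complex" n] in simp_all)
  have lcq: "coeff ?q n = 1" using assms by simp
  show ?thesis
  proof (rule ccontr)
    assume "?p \<noteq> ?q"
    then have nz: "?p - ?q \<noteq> 0" by simp
    have le: "degree (?p - ?q) \<le> n"
      by (rule degree_diff_le[OF eq_refl[OF degp] degq])
    have "coeff (?p - ?q) n = 0" using lcp lcq by simp
    then have lt: "degree (?p - ?q) < n"
      using le nz by (metis leading_coeff_0_iff order_less_le)
    have "{z. z ^ n = 1} \<subseteq> {z. poly (?p - ?q) z = 0}"
      using fin by (auto simp: poly_prod poly_monom)
    from card_mono[OF poly_roots_finite[OF nz] this] card card_poly_roots_bound[OF nz] lt
    show False by simp
  qed
qed

lemma roots_unity_eq_UN_primitive: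
  assumes "n > 0"
  shows "{z. z ^ n = 1} = (\<Union>d\<in>{d. d dvd n}. primitive_roots d)"
proof (intro equalityI subsetI)
  fix z :: complex assume "z \<in> {z. z ^ n = 1}"
  then have z: "z ^ n = 1" by simp
  define d where "d = (LEAST d. 0 < d \<and> z ^ d = 1)"
  have d: "0 < d \<and> z ^ d = 1"
    unfolding d_def by (rule LeastI[of _ n]) (use z assms in auto)
  have least: "z ^ j \<noteq> 1" if "0 < j" "j < d" for j
    using that not_less_Least[of j "\<lambda>d. 0 < d \<and> z ^ d = 1"] by (auto simp: d_def)
  have "z ^ (d * (n div d) + n mod d) = 1" by (simp only: mult_div_mod_eq z)
  then have "z ^ (n mod d) = 1" using d by (simp only: power_add power_mult) simp
  then have "n mod d = 0" using least[of "n mod d"] d by fastforce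
  then show "z \<in> (\<Union>d\<in>{d. d dvd n}. primitive_roots d)"
    using d least by (auto simp: primitive_roots_def mod_eq_0_iff_dvd)
next
  fix z :: complex assume "z \<in> (\<Union>d\<in>{d. d dvd n}. primitive_roots d)"
  then obtain d k where "n = d * k" "z ^ d = 1"
    unfolding primitive_roots_def dvd_def by blast
  then show "z \<in> {z. z ^ n = 1}" by (simp add: power_mult)
qed

lemma primitive_roots_disjoint:
  assumes "0 < d" "0 < e" "d \<noteq> e"
  shows "primitive_roots d \<inter> primitive_roots e = {}"
  using assms unfolding primitive_roots_def neq_iff by blast

lemma cyclotomic_exists:
  "m > 0 \<Longrightarrow> \<exists>p. map_poly of_int p = (\<Prod>z\<in>primitive_roots m. [:- z, 1:])"
proof (induction m rule: less_induct)
  case (less m)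
  let ?P = "\<lambda>d. \<Prod>z\<in>primitive_roots d. [:- z, 1:]"
  let ?h = "map_poly of_int :: int poly \<Rightarrow> complex poly"
  define E where "E = {d. d dvd m \<and> d \<noteq> m}"
  have divs: "{d. d dvd m} = insert m E" and "m \<notin> E" by (auto simp: E_def)
  have finE: "finite E"
    by (rule finite_subset[OF _ finite_divisors_nat[OF less.prems]]) (auto simp: E_def)
  have E: "0 < d" "d < m" if "d \<in> E" for d
    using that less.prems dvd_imp_le[of d m] by (auto simp: E_def intro!: Nat.gr0I)
  have "\<forall>d\<in>E. \<exists>p. ?h p = ?P d" using less.IH E by blast
  then obtain f where f: "\<And>d. d \<in> E \<Longrightarrow> ?h (f d) = ?P d" by metis
  define A where "A = (\<Prod>d\<in>E. f d)"
  have hA: "?h A = (\<Prod>d\<in>E. ?P d)"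
    by (simp add: A_def map_poly_of_int_prod f)
  have finP: "finite (primitive_roots d)" if "d > 0" for d
  proof (rule finite_subset)
    show "primitive_roots d \<subseteq> {z. z ^ d = 1}" unfolding primitive_roots_def by blast
    show "finite {z::complex. z ^ d = 1}" using finite_roots_unity[of d] that by simp
  qed
  have "?h (monom 1 m - 1) = monom 1 m - 1"
    by (rule poly_eqI) (simp add: coeff_map_poly)
  also have "\<dots> = (\<Prod>z\<in>(\<Union>d\<in>insert m E. primitive_roots d). [:- z, 1:])"
    using prod_roots_unity[OF less.prems] roots_unity_eq_UN_primitive[OF less.prems]
    by (simp add: divs)
  also have "\<dots> = (\<Prod>d\<in>insert m E. ?P d)"
  proof (rule prod.UNION_disjoint)
    have pos: "0 < d" if "d \<in> insert m E" for d using that E less.prems by blast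
    show "\<forall>d\<in>insert m E. finite (primitive_roots d)" using pos finP by blast
    show "\<forall>d\<in>insert m E. \<forall>e\<in>insert m E. d \<noteq> e \<longrightarrow>
        primitive_roots d \<inter> primitive_roots e = {}"
      using pos primitive_roots_disjoint by blast
  qed (use finE in simp)
  also have "\<dots> = ?h A * ?P m" using finE \<open>m \<notin> E\<close> by (simp add: hA mult.commute)
  finally have eq: "?h (monom 1 m - 1) = ?h A * ?P m" .
  have "lead_coeff (?h A) = 1" by (simp add: hA lead_coeff_prod)
  moreover have "lead_coeff (?h A) = of_int (lead_coeff A)"
    by (simp add: coeff_map_poly degree_map_poly)
  ultimately have "lead_coeff A = 1" by (metis of_int_eq_1_iff)
  from exact_quotient_integral[OF this eq] show ?case .
qed

lemma map_poly_cyclotomic: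
  assumes "m > 0"
  shows "map_poly of_int (cyclotomic m) = (\<Prod>z\<in>primitive_roots m. [:- z, 1:])"
proof -
  obtain p where p: "map_poly of_int p = (\<Prod>z\<in>primitive_roots m. [:- z, 1:])"
    using cyclotomic_exists[OF assms] by blast
  have "\<exists>!p. map_poly of_int p = (\<Prod>z\<in>primitive_roots m. [:- z, 1:])"
    by (rule ex1I[of _ p]) (auto simp: p intro!: map_poly_of_int_inj)
  then show ?thesis unfolding cyclotomic_def by (rule theI')
qed

definition k_bar :: "nat list \<Rightarrow> nat" where
  "k_bar ks = 2 * (foldr Bit_Operations.or ks 0 div 2) + 1"

end

theory Submission
  imports Defs
begin

text \<open>Let \<open>E\<close> be the shift on sequences and let \<open>K = k\<^sub>1 \<or> \<dots> \<or> k\<^sub>s\<close>. By Lucas, the sign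
  \<open>(-1)^(\<Sum>i. j choose k\<^sub>i)\<close> depends only on the binary digits of \<open>j\<close> at the positions
  where \<open>K\<close> has a digit 1. If \<open>f(j)\<close> depends only on the digits at a finite set of positions with
  largest element \<open>b\<close>, then \<open>f(j) + f(j + 2^b)\<close> no longer depends on the digit at \<open>b\<close>: adding
  \<open>2^b\<close> flips it and leaves the lower ones alone. Hence the sign sequence is killed by \<open>E - 1\<close>
  times the product of \<open>E^(2^b) + 1 = \<Phi>\<^bsub>2^(b+1)\<^esub>(E)\<close> over these positions, and the binomial transform
  replaces \<open>E\<close> by \<open>E - 1\<close>. The position 0 contributes \<open>\<Phi>\<^sub>2(E - 1) = E\<close>, which is
  absorbed by starting the sequence at index 1. Finally, by Gauss's lemma the characteristic
  polynomial of the minimal integer recurrence divides every integer polynomial that kills the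
  sequence.\<close>

section \<open>Polynomials in the shift operator\<close>

definition shift_poly :: "'a::comm_ring_1 poly \<Rightarrow> (nat \<Rightarrow> 'a) \<Rightarrow> nat \<Rightarrow> 'a" where
  "shift_poly p x n = (\<Sum>i\<le>degree p. coeff p i * x (n + i))"

lemma shift_poly_altdef:
  assumes "degree p \<le> N"
  shows "shift_poly p x n = (\<Sum>i\<le>N. coeff p i * x (n + i))"
  unfolding shift_poly_def
  by (rule sum.mono_neutral_left) (use assms in \<open>auto simp: coeff_eq_0\<close>)

lemma shift_poly_0 [simp]: "shift_poly 0 x n = 0"
  by (simp add: shift_poly_def)

lemma shift_poly_pCons [simp]:
  "shift_poly (pCons c p) x n = c * x n + shift_poly p x (Suc n)"
  by (subst shift_poly_altdef[of _ "Suc (degree p)"])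
     (auto simp: degree_pCons_le sum.atMost_Suc_shift shift_poly_def simp del: sum.atMost_Suc)

lemma shift_poly_add: "shift_poly (p + q) x n = shift_poly p x n + shift_poly q x n"
  by (induction p q arbitrary: n rule: poly_induct2) (auto simp: algebra_simps)

lemma shift_poly_smult: "shift_poly (smult c p) x n = c * shift_poly p x n"
  by (induction p arbitrary: n) (auto simp: algebra_simps)

lemma shift_poly_diff: "shift_poly (p - q) x n = shift_poly p x n - shift_poly q x n"
  using shift_poly_add[of "p - q" q x n] by simp

lemma shift_poly_sum: "shift_poly (\<Sum>i\<in>A. p i) x n = (\<Sum>i\<in>A. shift_poly (p i) x n)"
  by (induction A rule: infinite_finite_induct) (auto simp: shift_poly_add)

lemma shift_poly_monom: "shift_poly (monom c m) x n = c * x (n + m)"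
  by (induction m arbitrary: n) (auto simp: monom_0 monom_Suc)

lemma shift_poly_cong: "(\<And>n. x n = y n) \<Longrightarrow> shift_poly p x n = shift_poly p y n"
  by (simp add: shift_poly_def)

lemma shift_poly_mult: "shift_poly (p * q) x n = shift_poly p (shift_poly q x) n"
  by (induction p arbitrary: n) (auto simp: shift_poly_add shift_poly_smult)

lemma shift_poly_Suc: "shift_poly p (\<lambda>n. x (Suc n)) n = shift_poly p x (Suc n)"
  by (simp add: shift_poly_def)

definition binomial_transform :: "(nat \<Rightarrow> 'a::comm_ring_1) \<Rightarrow> nat \<Rightarrow> 'a" where
  "binomial_transform f n = (\<Sum>j\<le>n. of_nat (n choose j) * f j)"

text \<open>Pascal's rule. In operator form, \<open>E - 1\<close> applied to the transform of
  \<open>f\<close> gives the transform of the shifted \<open>f\<close>.\<close>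

lemma binomial_transform_Suc:
  "binomial_transform f (Suc n) = binomial_transform f n + binomial_transform (\<lambda>j. f (Suc j)) n"
proof -
  have "binomial_transform f (Suc n)
      = f 0 + (\<Sum>j\<le>n. of_nat (n choose Suc j) * f (Suc j)) + binomial_transform (\<lambda>j. f (Suc j)) n"
    by (simp add: binomial_transform_def sum.atMost_Suc_shift algebra_simps sum.distrib
          del: sum.atMost_Suc)
  also have "f 0 + (\<Sum>j\<le>n. of_nat (n choose Suc j) * f (Suc j))
      = (\<Sum>j\<le>Suc n. of_nat (n choose j) * f j)"
    by (simp add: sum.atMost_Suc_shift del: sum.atMost_Suc)
  also have "\<dots> = binomial_transform f n"
    by (simp add: binomial_transform_def binomial_eq_0)
  finally show ?thesis .
qed

text \<open>Each factor \<open>E - 1\<close> passes through the transform and becomes an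
  \<open>E\<close>; Horner form and induction on \<open>p\<close> do the rest.\<close>

lemma shift_poly_binomial_transform:
  "shift_poly (pcompose p [:-1, 1:]) (binomial_transform f) n = binomial_transform (shift_poly p f) n"
proof (induction p arbitrary: f n)
  case 0
  show ?case by (simp add: binomial_transform_def)
next
  case (pCons c p)
  have diff: "shift_poly [:-1, 1:] (binomial_transform f) m = binomial_transform (\<lambda>j. f (Suc j)) m" for m
    by (simp add: binomial_transform_Suc)
  have "shift_poly (pcompose (pCons c p) [:-1, 1:]) (binomial_transform f) n
      = c * binomial_transform f n
        + shift_poly (pcompose p [:-1, 1:] * [:-1, 1:]) (binomial_transform f) n"
    by (simp only: pcompose_pCons shift_poly_add mult.commute) simp
  also have "shift_poly (pcompose p [:-1, 1:] * [:-1, 1:]) (binomial_transform f) n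
      = binomial_transform (shift_poly p (\<lambda>j. f (Suc j))) n"
    unfolding shift_poly_mult shift_poly_cong[of _ _ "pcompose p [:-1, 1:]", OF diff] by (rule pCons.IH)
  finally show ?case
    by (simp add: binomial_transform_def shift_poly_Suc algebra_simps sum.distrib sum_distrib_left)
qed

section \<open>Minimal linear recurrences\<close>

lemma shift_poly_rec_char_poly:
  "shift_poly (rec_char_poly D a) x n = x (n + D) - (\<Sum>i=1..D. a i * x (n + (D - i)))"
  by (simp add: rec_char_poly_def shift_poly_diff shift_poly_sum shift_poly_monom)

text \<open>The indices above \<open>D\<close> are written as \<open>n + D\<close> with
  \<open>n \<ge> 1\<close>, so the value at 0 stays out.\<close>

lemma satisfies_lin_rec_iff:
  "satisfies_lin_rec x D a \<longleftrightarrow> (\<forall>n\<ge>1. shift_poly (rec_char_poly D a) x n = 0)"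
proof -
  have "(\<forall>m>D. P m) \<longleftrightarrow> (\<forall>n\<ge>1. P (n + D))" for P :: "nat \<Rightarrow> bool"
  proof (intro iffI allI impI)
    fix m assume "\<forall>n\<ge>1. P (n + D)" "D < m"
    then show "P m" by (auto dest: spec[of _ "m - D"])
  qed auto
  moreover have "x (n + D) = (\<Sum>i=1..D. a i * x (n + D - i))
      \<longleftrightarrow> shift_poly (rec_char_poly D a) x n = 0" for n
    by (auto simp: shift_poly_rec_char_poly intro!: sum.cong)
  ultimately show ?thesis
    unfolding satisfies_lin_rec_def by simp
qed

lemma degree_rec_char_poly: "degree (rec_char_poly D a) = D"
  and lead_coeff_rec_char_poly: "lead_coeff (rec_char_poly D a) = 1"
proof -
  have c: "coeff (rec_char_poly D a) m = (if m = D then 1 else 0)" if "m \<ge> D" for m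
    using that by (auto simp: rec_char_poly_def coeff_sum intro!: sum.neutral)
  show "degree (rec_char_poly D a) = D"
    by (intro antisym degree_le le_degree) (auto simp: c)
  then show "lead_coeff (rec_char_poly D a) = 1" by (simp add: c)
qed

text \<open>Turns every monic annihilator into a recurrence, so that minimality of \<open>D\<close>
  applies to it.\<close>

lemma monic_eq_rec_char_poly:
  assumes "lead_coeff p = 1"
  shows "p = rec_char_poly (degree p) (\<lambda>i. - coeff p (degree p - i))"
proof (rule poly_eqI)
  fix m
  let ?d = "degree p"
  have "(\<Sum>i=1..?d. if ?d - i = m then - coeff p (?d - i) else 0)
      = (\<Sum>i\<in>{1..?d}. if i = ?d - m \<and> m < ?d then - coeff p m else 0)"
    by (intro sum.cong) auto
  also have "\<dots> = (if m < ?d then - coeff p m else 0)"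
    by (auto simp: sum.delta)
  finally show "coeff p m = coeff (rec_char_poly ?d (\<lambda>i. - coeff p (?d - i))) m"
    using assms by (auto simp: rec_char_poly_def coeff_sum coeff_eq_0)
qed

text \<open>Minimality speaks of monic polynomials only; this extends the bound to all nonzero
  annihilators. One of least degree divides the monic \<open>rec_char_poly D a\<close> over the
  rationals, so by Gauss's lemma its primitive part has leading coefficient 1 or -1.\<close>

lemma minimal_lin_rec_degree_le:
  assumes "minimal_lin_rec x D a" and "r \<noteq> 0" and "\<And>n. n \<ge> 1 \<Longrightarrow> shift_poly r x n = 0"
  shows "D \<le> degree r"
proof -
  define ann where "ann p \<longleftrightarrow> p \<noteq> 0 \<and> (\<forall>n\<ge>1. shift_poly p x n = 0)" for p
  have min: "D \<le> degree p" if "lead_coeff p = 1" "ann p" for p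
    using assms(1) that monic_eq_rec_char_poly[OF that(1)]
    unfolding minimal_lin_rec_def satisfies_lin_rec_iff ann_def by metis
  have annP: "ann (rec_char_poly D a)"
    using assms(1) lead_coeff_rec_char_poly[of D a]
    unfolding minimal_lin_rec_def satisfies_lin_rec_iff ann_def by force
  have "ann r" using assms by (simp add: ann_def)
  then obtain p0 where p0: "ann p0" and least0: "\<And>q. ann q \<Longrightarrow> degree p0 \<le> degree q"
    using ex_has_least_nat[of ann r degree] by blast
  define p where "p = primitive_part p0"
  have p0_eq: "p0 = smult (content p0) p" by (simp add: p_def)
  have "p \<noteq> 0" "content p0 \<noteq> 0" using p0 by (auto simp: ann_def p_def)
  have "content p = 1" using p0 by (simp add: p_def ann_def)
  have "ann p"
    using p0 \<open>p \<noteq> 0\<close> \<open>content p0 \<noteq> 0\<close> unfolding ann_def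
    by (subst (asm) p0_eq, subst (asm) (2) p0_eq) (simp add: shift_poly_smult)
  have degp: "degree p = degree p0" by (simp add: p_def)
  let ?P = "rec_char_poly D a"
  obtain q s where qs: "pseudo_divmod ?P p = (q, s)" by force
  \<comment> \<open>\<open>p\<close> is not yet known to be monic, so integral division costs this
    power of its leading coefficient.\<close>
  define c where "c = lead_coeff p ^ (Suc (degree ?P) - degree p)"
  have eq: "smult c ?P = p * q + s" and s: "s = 0 \<or> degree s < degree p"
    using pseudo_divmod[OF \<open>p \<noteq> 0\<close> qs] by (auto simp: c_def)
  \<comment> \<open>A nonzero remainder would be an annihilator of degree below the least
    one.\<close>
  have "s = 0"
  proof (rule ccontr)
    assume "s \<noteq> 0"
    have "shift_poly s x n = 0" if "n \<ge> 1" for n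
    proof -
      have "s = smult c ?P - q * p" using eq by (simp add: algebra_simps)
      moreover have "shift_poly (q * p) x n = 0"
        unfolding shift_poly_mult using \<open>ann p\<close> that
        by (simp add: ann_def shift_poly_def[of q])
      ultimately show ?thesis
        using annP that by (simp add: shift_poly_diff shift_poly_smult ann_def)
    qed
    then have "ann s" using \<open>s \<noteq> 0\<close> by (simp add: ann_def)
    from least0[OF this] s \<open>s \<noteq> 0\<close> degp show False by simp
  qed
  have "c \<noteq> 0" using \<open>p \<noteq> 0\<close> by (simp add: c_def)
  have "content ?P = 1"
    by (metis content_dvd_coeff is_unit_content_iff lead_coeff_rec_char_poly)
  \<comment> \<open>Content is multiplicative, so \<open>q\<close> carries all of \<open>c\<close>
    up to sign, and \<open>c\<close> can be cancelled.\<close>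
  with eq \<open>s = 0\<close> \<open>content p = 1\<close> have "content q = normalize c"
    by (metis add.right_neutral content_mult content_smult mult.right_neutral mult_1)
  then have "smult c ?P = smult (normalize c) (p * primitive_part q)"
    using eq \<open>s = 0\<close> content_times_primitive_part[of q]
    by (metis add.right_neutral mult_smult_right)
  then have "smult (normalize c) (p * primitive_part q) = smult (normalize c) (smult (unit_factor c) ?P)"
    by (metis mult.commute smult_smult unit_factor_mult_normalize)
  then have "p * primitive_part q = smult (unit_factor c) ?P"
    using \<open>c \<noteq> 0\<close> by (metis normalize_eq_0_iff smult_cancel)
  then have "lead_coeff p * lead_coeff (primitive_part q) = unit_factor c"
    by (metis lead_coeff_mult lead_coeff_rec_char_poly lead_coeff_smult mult.right_neutral)
  then have "is_unit (lead_coeff p)"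
    using \<open>c \<noteq> 0\<close> by (metis dvd_trans dvd_triv_left unit_factor_is_unit)
  then have "\<bar>lead_coeff p\<bar> = 1" by simp
  define p' where "p' = smult (lead_coeff p) p"
  have "lead_coeff p * lead_coeff p = 1"
    using \<open>\<bar>lead_coeff p\<bar> = 1\<close> by (metis abs_mult_self_eq mult.right_neutral)
  then have "lead_coeff p' = 1" using \<open>p \<noteq> 0\<close> by (simp add: p'_def)
  moreover have "ann p'" using \<open>ann p\<close> by (auto simp: ann_def p'_def shift_poly_smult)
  ultimately have "D \<le> degree p'" by (rule min)
  also have "\<dots> \<le> degree p" by (simp add: p'_def)
  also have "\<dots> \<le> degree r" using least0[OF \<open>ann r\<close>] degp by simp
  finally show ?thesis .
qed

text \<open>Division by a monic polynomial stays integral. The remainder also kills the sequence;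
  were it nonzero, its degree below \<open>D\<close> would contradict the preceding bound.\<close>

lemma rec_char_poly_dvd:
  assumes "minimal_lin_rec x D a" and "\<And>n. n \<ge> 1 \<Longrightarrow> shift_poly Q x n = 0"
  shows "rec_char_poly D a dvd Q"
proof -
  let ?P = "rec_char_poly D a"
  obtain q r where qr: "pseudo_divmod Q ?P = (q, r)" by force
  have lc: "lead_coeff ?P = 1" by (rule lead_coeff_rec_char_poly)
  then have "?P \<noteq> 0" by force
  from pseudo_divmod[OF this qr] lc
  have eq: "Q = ?P * q + r" and r: "r = 0 \<or> degree r < degree ?P" by simp_all
  have "shift_poly r x n = 0" if "n \<ge> 1" for n
  proof -
    have "r = Q - q * ?P" using eq by simp
    moreover have "shift_poly (q * ?P) x n = 0"
      unfolding shift_poly_mult using assms(1) that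
      by (simp add: minimal_lin_rec_def satisfies_lin_rec_iff shift_poly_def[of q])
    ultimately show ?thesis using assms(2)[OF that] by (simp add: shift_poly_diff)
  qed
  then have "r = 0"
    using minimal_lin_rec_degree_le[OF assms(1), of r] r degree_rec_char_poly[of D a]
    by (metis linorder_not_less)
  then show ?thesis using eq by simp
qed

section \<open>Sequences depending on finitely many binary digits\<close>

definition depends_on_bits :: "nat set \<Rightarrow> (nat \<Rightarrow> 'a) \<Rightarrow> bool" where
  "depends_on_bits A f \<longleftrightarrow> (\<forall>i j. (\<forall>b\<in>A. bit i b = bit j b) \<longrightarrow> f i = f j)"

lemma depends_on_bits_mono: "depends_on_bits A f \<Longrightarrow> A \<subseteq> B \<Longrightarrow> depends_on_bits B f"
  unfolding depends_on_bits_def by (meson subsetD)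

text \<open>Carries only move upwards: after division by \<open>2 ^ c\<close> the summand is
  \<open>2 ^ (b - c)\<close>, odd exactly when \<open>c = b\<close>.\<close>

lemma bit_add_power_2:
  fixes j :: nat
  assumes "c \<le> b"
  shows "bit (j + 2 ^ b) c \<longleftrightarrow> (if c = b then \<not> bit j c else bit j c)"
proof -
  have "(2::nat) ^ b = 2 ^ (b - c) * 2 ^ c"
    using assms by (simp flip: power_add)
  then have "(j + 2 ^ b) div 2 ^ c = j div 2 ^ c + 2 ^ (b - c)"
    by simp
  then show ?thesis using assms by (auto simp: bit_iff_odd)
qed

lemma depends_on_bits_flip_top:
  assumes "depends_on_bits (insert b A) f" and "\<forall>c\<in>A. c < b"
  shows "depends_on_bits A (shift_poly (monom 1 (2 ^ b) + 1) f)"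
  unfolding depends_on_bits_def
proof (intro allI impI)
  fix i j :: nat
  assume ij: "\<forall>c\<in>A. bit i c = bit j c"
  have f: "f i' = f j'" if "bit i' b = bit j' b" "\<forall>c\<in>A. bit i' c = bit j' c" for i' j'
    using assms(1) that unfolding depends_on_bits_def by blast
  have low: "bit (m + 2 ^ b) c = bit m c" if "c \<in> A" for c m :: nat
    using bit_add_power_2[of c b m] assms(2) that by auto
  have top: "bit (m + 2 ^ b) b = (\<not> bit m b)" for m :: nat
    using bit_add_power_2[of b b m] by simp
  have "f (i + 2 ^ b) + f i = f (j + 2 ^ b) + f j"
  proof (cases "bit i b = bit j b")
    case True
    then show ?thesis using f[of i j] f[of "i + 2 ^ b" "j + 2 ^ b"] ij low top by simp
  next
    \<comment> \<open>The digits at \<open>b\<close> differ, so the two terms for \<open>i\<close>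
      match those for \<open>j\<close> crosswise.\<close>
    case False
    then show ?thesis
      using f[of "i + 2 ^ b" j] f[of i "j + 2 ^ b"] ij low top by (simp add: add.commute)
  qed
  then show "shift_poly (monom 1 (2 ^ b) + 1) f i = shift_poly (monom 1 (2 ^ b) + 1) f j"
    by (simp add: shift_poly_add shift_poly_monom one_pCons)
qed

text \<open>The largest position has to be removed first, and the last factor of the product acts
  first; hence induction from the end of the list.\<close>

lemma depends_on_bits_prod_list:
  assumes "sorted_wrt (<) bs" and "depends_on_bits (set bs) f"
  shows "depends_on_bits {} (shift_poly (\<Prod>b\<leftarrow>bs. monom 1 (2 ^ b) + 1) f)"
  using assms
proof (induction bs arbitrary: f rule: rev_induct)
  case Nil
  then show ?case by (simp add: depends_on_bits_def one_pCons)
next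
  case (snoc b bs)
  from snoc.prems have "depends_on_bits (set bs) (shift_poly (monom 1 (2 ^ b) + 1) f)"
    by (intro depends_on_bits_flip_top) (auto simp: sorted_wrt_append)
  from snoc.IH[OF _ this] snoc.prems(1) show ?case
    by (simp add: sorted_wrt_append shift_poly_mult depends_on_bits_def)
qed

lemma shift_poly_prod_list_eq_0:
  assumes "sorted_wrt (<) bs" and "depends_on_bits (set bs) f"
  shows "shift_poly ([:-1, 1:] * (\<Prod>b\<leftarrow>bs. monom 1 (2 ^ b) + 1)) f n = 0"
  using depends_on_bits_prod_list[OF assms]
  unfolding shift_poly_mult depends_on_bits_def by simp

section \<open>Parity of binomial coefficients\<close>

text \<open>One digit of Lucas's theorem modulo 2, obtained from Pascal's rule by cases on
  parities.\<close>

lemma odd_binomial_iff_div_2: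
  "odd (j choose k) \<longleftrightarrow> odd (j div 2 choose (k div 2)) \<and> (odd k \<longrightarrow> odd j)"
proof (induction j arbitrary: k)
  case 0
  consider "k = 0" | "k = 1" | "k \<ge> 2" by linarith
  then show ?case by cases (auto simp: binomial_eq_0 div_greater_zero_iff)
next
  case (Suc j)
  show ?case
  proof (cases k)
    case 0
    then show ?thesis by simp
  next
    case (Suc k')
    have "odd (Suc j choose k) \<longleftrightarrow> odd (j choose k') \<noteq> odd (j choose Suc k')"
      by (simp add: Suc)
    also have "\<dots> \<longleftrightarrow> odd (Suc j div 2 choose (k div 2)) \<and> (odd k \<longrightarrow> odd (Suc j))"
      unfolding Suc.IH Suc by (cases "even j"; cases "even k'") (auto elim!: evenE oddE)
    finally show ?thesis .
  qed
qed

text \<open>Iterates the one-digit step, halving \<open>k\<close> until it is 0.\<close>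

lemma odd_binomial_cong:
  assumes "\<And>b. bit k b \<Longrightarrow> bit i b = bit j b"
  shows "odd (i choose k) \<longleftrightarrow> odd (j choose k)"
  using assms
proof (induction k arbitrary: i j rule: less_induct)
  case (less k)
  show ?case
  proof (cases "k = 0")
    case False
    have "odd (i div 2 choose (k div 2)) \<longleftrightarrow> odd (j div 2 choose (k div 2))"
      using False less.prems by (intro less.IH) (auto simp flip: bit_Suc)
    moreover have "odd k \<longrightarrow> odd i = odd j"
      using less.prems[of 0] by (simp add: bit_0)
    ultimately show ?thesis
      by (subst (1 2) odd_binomial_iff_div_2) auto
  qed simp
qed

lemma depends_on_bits_sign:
  "depends_on_bits {b. \<exists>k\<in>set ks. bit k b} (\<lambda>j. (-1 :: int) ^ (\<Sum>k\<leftarrow>ks. j choose k))"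
  unfolding depends_on_bits_def
proof (intro allI impI)
  fix i j :: nat
  assume "\<forall>b\<in>{b. \<exists>k\<in>set ks. bit k b}. bit i b = bit j b"
  then have "\<forall>k\<in>set ks. odd (i choose k) \<longleftrightarrow> odd (j choose k)"
    by (intro ballI odd_binomial_cong) blast
  then have "odd (\<Sum>k\<leftarrow>ks. i choose k) \<longleftrightarrow> odd (\<Sum>k\<leftarrow>ks. j choose k)"
    by (induction ks) auto
  then show "(-1 :: int) ^ (\<Sum>k\<leftarrow>ks. i choose k) = (-1) ^ (\<Sum>k\<leftarrow>ks. j choose k)"
    by (simp add: minus_one_power_iff)
qed

text \<open>Distinct powers of 2 add without carries, so the sum is a bitwise or.\<close>

lemma bit_sum_list_power_2:
  "distinct bs \<Longrightarrow> bit (\<Sum>b\<leftarrow>bs. (2::nat) ^ b) c \<longleftrightarrow> c \<in> set bs"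
proof (induction bs arbitrary: c)
  case (Cons b bs)
  then have "2 ^ b + (\<Sum>b\<leftarrow>bs. (2::nat) ^ b) = or (2 ^ b) (\<Sum>b\<leftarrow>bs. 2 ^ b)"
    by (intro disjunctive_add) (auto simp: bit_exp_iff)
  then show ?case using Cons by (auto simp: bit_or_iff bit_exp_iff)
qed simp

lemma bit_foldr_or: "bit (foldr Bit_Operations.or ks (0::nat)) b \<longleftrightarrow> (\<exists>k\<in>set ks. bit k b)"
  by (induction ks) (auto simp: bit_or_iff)

lemma bit_k_bar: "bit (k_bar ks) b \<longleftrightarrow> b = 0 \<or> (\<exists>k\<in>set ks. bit k b)"
  unfolding bit_foldr_or[symmetric] by (cases b) (auto simp: k_bar_def bit_0 bit_Suc)

section \<open>Cyclotomic polynomials of 2-power order\<close>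

text \<open>A divisor of \<open>?N\<close> is \<open>?N\<close> itself or divides \<open>?M\<close>,
  so the roots of unity of order exactly \<open>?N\<close> are the roots of \<open>x^?N - 1\<close>
  that are not roots of \<open>x^?M - 1\<close>; the quotient is \<open>x^?M + 1\<close>.\<close>

lemma cyclotomic_power_2: "cyclotomic (2 ^ (b + 1)) = monom 1 (2 ^ b) + 1"
proof (rule map_poly_of_int_inj)
  let ?R = "\<lambda>n. {z::complex. z ^ n = 1}"
  let ?N = "2 ^ (b + 1) :: nat" and ?M = "2 ^ b :: nat"
  have "{d. d dvd ?N} = insert ?N {d. d dvd ?M}"
    unfolding divides_primepow_nat[OF two_is_prime_nat]
    by (auto simp: le_Suc_eq simp del: power_Suc)
  then have R: "?R ?N = primitive_roots ?N \<union> ?R ?M"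
    unfolding roots_unity_eq_UN_primitive[OF zero_less_power[OF zero_less_numeral]] by auto
  have disj: "primitive_roots ?N \<inter> ?R ?M = {}"
    by (auto simp: primitive_roots_def)
  have fin: "finite (?R n)" if "n > 0" for n
    using finite_roots_unity[of n] that by simp
  have finP: "finite (primitive_roots ?N)" using fin[of ?N] R by simp
  have "(\<Prod>z\<in>primitive_roots ?N. [:- z, 1:]) * (monom 1 ?M - 1)
      = (\<Prod>z\<in>?R ?N. [:- z, 1:])"
    unfolding R by (subst prod.union_disjoint) (use finP fin[of ?M] disj prod_roots_unity[of ?M] in auto)
  also have "\<dots> = (monom 1 ?M + 1) * (monom 1 ?M - 1)"
    by (subst prod_roots_unity) (auto simp: algebra_simps mult_monom mult_2)
  finally have "(\<Prod>z\<in>primitive_roots ?N. [:- z, 1:]) = monom 1 ?M + 1"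
  proof (rule mult_right_cancel[THEN iffD1, rotated])
    have "coeff (monom 1 ?M - 1 :: complex poly) ?M = 1" by simp
    then show "(monom 1 ?M - 1 :: complex poly) \<noteq> 0" by force
  qed
  then show "map_poly of_int (cyclotomic ?N) = (map_poly of_int (monom 1 ?M + 1) :: complex poly)"
    by (subst map_poly_cyclotomic) (auto intro!: poly_eqI simp: coeff_map_poly)
qed

lemma pcompose_prod_list: "pcompose (\<Prod>b\<leftarrow>bs. f b) q = (\<Prod>b\<leftarrow>bs. pcompose (f b) q)"
  by (induction bs) (auto simp: pcompose_mult pcompose_1)

lemma sym_sum_eq_binomial_transform:
  "sym_sum ks = binomial_transform (\<lambda>j. (-1) ^ (\<Sum>k\<leftarrow>ks. j choose k))"
  by (rule ext) (simp add: sym_sum_def binomial_transform_def atMost_atLeast0 mult.commute)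

theorem mainTheorem4:
  fixes ks as :: "nat list" and D :: nat and a :: "nat \<Rightarrow> int"
  assumes "ks \<noteq> []" and "sorted_wrt (<) ks" and "\<forall>k\<in>set ks. 1 \<le> k"
    and "minimal_lin_rec (sym_sum ks) D a"
    and "sorted_wrt (<) as" and "\<forall>b\<in>set as. 1 \<le> b"
    and "k_bar ks = 1 + (\<Sum>b\<leftarrow>as. 2 ^ b)"
    and "as \<noteq> [] \<longrightarrow> int (last as) = \<lfloor>log 2 (real (k_bar ks))\<rfloor>"
  shows "rec_char_poly D a dvd
    [:- 2, 1:] * (\<Prod>b\<leftarrow>as. pcompose (cyclotomic (2 ^ (b + 1))) [:- 1, 1:])"
proof (rule rec_char_poly_dvd[OF assms(4)])
  fix n :: nat
  assume "n \<ge> 1"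
  then obtain m where n: "n = Suc m" by (cases n) auto
  let ?f = "\<lambda>j. (-1 :: int) ^ (\<Sum>k\<leftarrow>ks. j choose k)"
  let ?Q = "[:- 2, 1:] * (\<Prod>b\<leftarrow>as. pcompose (cyclotomic (2 ^ (b + 1))) [:- 1, 1:])"
  \<comment> \<open>\<open>0 # as\<close> lists the positions of the digits 1 of
    \<open>k_bar ks\<close>; \<open>?F\<close> will kill the sign sequence
    \<open>?f\<close>.\<close>
  let ?F = "[:-1, 1:] * (\<Prod>b\<leftarrow>0 # as. monom 1 (2 ^ b) + 1) :: int poly"
  have sorted: "sorted_wrt (<) (0 # as)"
    using assms(5,6) by auto
  have "k_bar ks = (\<Sum>b\<leftarrow>0 # as. 2 ^ b)" using assms(7) by simp
  then have "set (0 # as) = {b. bit (k_bar ks) b}"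
    using bit_sum_list_power_2[of "0 # as"] sorted
    by (auto simp: strict_sorted_iff simp del: sum_list.Cons list.map)
  \<comment> \<open>Only an inclusion: \<open>k_bar ks\<close> has digit 0 set even if every
    \<open>k\<close> is even.\<close>
  then have "{b. \<exists>k\<in>set ks. bit k b} \<subseteq> set (0 # as)"
    by (auto simp: bit_k_bar)
  with depends_on_bits_sign have "depends_on_bits (set (0 # as)) ?f"
    by (rule depends_on_bits_mono)
  then have zero: "shift_poly ?F ?f = (\<lambda>_. 0)"
    using shift_poly_prod_list_eq_0[OF sorted] by blast
  \<comment> \<open>the digit 0 contributes the factor \<open>x = \<Phi>\<^sub>2(x - 1)\<close>\<close>
  have Phi2: "pcompose (monom 1 (2 ^ 0) + 1) [:-1, 1:] = ([:0, 1:] :: int poly)"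
    by (simp add: monom_Suc monom_0 one_pCons pcompose_pCons)
  have "pcompose [:-1, 1:] [:-1, 1:] = ([:-2, 1:] :: int poly)"
    by (simp add: pcompose_pCons)
  then have "pcompose ?F [:-1, 1:] = [:0, 1:] * ?Q"
    unfolding pcompose_mult pcompose_prod_list list.map prod_list.Cons Phi2 cyclotomic_power_2
    by (simp only: mult.left_commute)
  \<comment> \<open>The factor \<open>[:0, 1:]\<close> is \<open>E\<close> itself, which moves the
    index from \<open>m\<close> to \<open>Suc m\<close>.\<close>
  then have "shift_poly ?Q (sym_sum ks) (Suc m) = shift_poly (pcompose ?F [:-1, 1:]) (sym_sum ks) m"
    by simp
  also have "\<dots> = 0"
    unfolding sym_sum_eq_binomial_transform shift_poly_binomial_transform zero
    by (simp add: binomial_transform_def)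
  finally show "shift_poly ?Q (sym_sum ks) n = 0" by (simp add: n)
qed

end
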